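(* Let $\|\cdot\|$ be a monotone matrix norm on $\mathbb{R}^{n\times n}$ and let $\mathbf{A}=[\underline{A},\overline{A}]$ be an $n\times n$ real interval matrix with midpoint $A^c$. Then: (i) If $A^c\ge 0$, then $\overline{\|\mathbf{A}\|}=\|\overline{A}\|$. (ii) If $\mathbf{A}$ is nonnegative, then $\|\mathbf{A}\|=[\|\underline{A}\|,\|\overline{A}\|]$.
   Context: Inequalities between matrices and absolute values of matrices are entrywise. For $\underline{A}\le\overline{A}$ in $\mathbb{R}^{n\times n}$, the interval matrix is $\mathbf{A}=\{A\in\mathbb{R}^{n\times n} : \underline{A}\le A\le\overline{A}\}$, with midpoint $A^c=\frac12(\underline{A}+\overline{A})$. $\mathbf{A}$ is nonnegative if every $A\in\mathbf{A}$ is entrywise nonnegative (equivalently $\underline{A}\ge 0$). A matrix norm is monotone if $|A|\le B$ implies $\|A\|\le\|B\|$. $\|\mathbf{A}\|=\{\|A\| : A\in\mathbf{A}\}$, and $\overline{\|\mathbf{A}\|}=\max\{\|A\| : A\in\mathbf{A}\}$ is its upper endpoint. *)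

theory Defs
  imports "HOL-Analysis.Analysis"
begin

text \<open>
  On \<^typ>\<open>real^'n^'n\<close> the library's order and absolute value are the entrywise ones, so the
  interval matrix with endpoints \<open>L \<le> U\<close> is the order interval \<open>{L..U}\<close>.
\<close>

lemma matrix_le_iff_entrywise: "A \<le> B \<longleftrightarrow> (\<forall>i j. A $ i $ j \<le> B $ i $ j)"
  for A B :: "real^'n^'n"
  by (simp add: less_eq_vec_def)

lemma matrix_abs_entry: "\<bar>A\<bar> $ i $ j = \<bar>A $ i $ j\<bar>" for A :: "real^'n^'n"
  by (simp add: abs_vec_def)

lemma interval_matrix_eq:
  "{L..U} = {A. \<forall>i j. L $ i $ j \<le> A $ i $ j \<and> A $ i $ j \<le> U $ i $ j}"
  for L U :: "real^'n^'n"
  by (auto simp: matrix_le_iff_entrywise)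

text \<open>Norm on the vector space of matrices; submultiplicativity is not required.\<close>

definition matrix_norm :: "(real^'n^'n \<Rightarrow> real) \<Rightarrow> bool" where
  "matrix_norm N \<longleftrightarrow>
     (\<forall>A. 0 \<le> N A) \<and>
     (\<forall>A. N A = 0 \<longleftrightarrow> A = 0) \<and>
     (\<forall>c A. N (c *\<^sub>R A) = \<bar>c\<bar> * N A) \<and>
     (\<forall>A B. N (A + B) \<le> N A + N B)"

definition monotone_norm :: "(real^'n^'n \<Rightarrow> real) \<Rightarrow> bool" where
  "monotone_norm N \<longleftrightarrow> (\<forall>A B. \<bar>A\<bar> \<le> B \<longrightarrow> N A \<le> N B)"

definition midpoint_matrix :: "real^'n^'n \<Rightarrow> real^'n^'n \<Rightarrow> real^'n^'n" where
  "midpoint_matrix L U = (1 / 2) *\<^sub>R (L + U)"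

definition nonneg_matrix_set :: "(real^'n^'n) set \<Rightarrow> bool" where
  "nonneg_matrix_set \<A> \<longleftrightarrow> (\<forall>A\<in>\<A>. 0 \<le> A)"

definition norm_set :: "(real^'n^'n \<Rightarrow> real) \<Rightarrow> (real^'n^'n) set \<Rightarrow> real set" where
  "norm_set N \<A> = {N A | A. A \<in> \<A>}"

text \<open>
  \<^const>\<open>Max\<close> is only meaningful for finite sets, hence \<^const>\<open>Greatest\<close>. The maximum exists
  whenever the interval matrix is nonempty, see \<open>upper_norm_is_maximum\<close>.
\<close>

definition upper_norm :: "(real^'n^'n \<Rightarrow> real) \<Rightarrow> (real^'n^'n) set \<Rightarrow> real" where
  "upper_norm N \<A> = (GREATEST r. r \<in> norm_set N \<A>)"

lemma matrix_norm_continuous: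
  fixes N :: "real^'n^'n \<Rightarrow> real"
  assumes "matrix_norm N"
  shows "continuous_on UNIV N"
proof (rule convex_on_continuous)
  show "convex_on UNIV N"
  proof (rule convex_onI)
    fix t :: real and A B :: "real^'n^'n"
    assume t: "0 < t" "t < 1"
    have "N ((1 - t) *\<^sub>R A + t *\<^sub>R B) \<le> N ((1 - t) *\<^sub>R A) + N (t *\<^sub>R B)"
      using assms unfolding matrix_norm_def by blast
    also have "\<dots> = \<bar>1 - t\<bar> * N A + \<bar>t\<bar> * N B"
      using assms unfolding matrix_norm_def by metis
    finally show "N ((1 - t) *\<^sub>R A + t *\<^sub>R B) \<le> (1 - t) * N A + t * N B"
      using t by simp
  qed simp
qed simp

lemma upper_norm_is_maximum:
  fixes N :: "real^'n^'n \<Rightarrow> real" and L U :: "real^'n^'n"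
  assumes "matrix_norm N" and "L \<le> U"
  shows "upper_norm N {L..U} \<in> norm_set N {L..U}"
    and "\<forall>r\<in>norm_set N {L..U}. r \<le> upper_norm N {L..U}"
proof -
  have "compact {L..U}"
    by (metis compact_cbox cbox_interval)
  moreover have "{L..U} \<noteq> {}"
    using assms by auto
  moreover have "continuous_on {L..U} N"
    using matrix_norm_continuous[OF assms(1)] continuous_on_subset by blast
  ultimately obtain M where M: "M \<in> {L..U}" "\<forall>A\<in>{L..U}. N A \<le> N M"
    using continuous_attains_sup by blast
  have max: "N M \<in> norm_set N {L..U}" "\<forall>r\<in>norm_set N {L..U}. r \<le> N M"
    using M unfolding norm_set_def by auto
  have "upper_norm N {L..U} = N M"
    unfolding upper_norm_def by (rule Greatest_equality) (use max in auto)
  with max show "upper_norm N {L..U} \<in> norm_set N {L..U}"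
    and "\<forall>r\<in>norm_set N {L..U}. r \<le> upper_norm N {L..U}"
    by simp_all
qed

end

theory Submission
  imports Defs
begin

text \<open>A nonnegative midpoint means that, entrywise, the upper endpoint is at least as large in
  modulus as the lower one, so \<open>U\<close> dominates \<open>\<bar>A\<bar>\<close> for every
  \<open>A\<close> in the interval (\<open>abs_le_upper_of_midpoint_nonneg\<close>). Monotonicity of
  the norm then makes \<open>N U\<close> the maximum. If all members are nonnegative, the norm is
  order preserving on the interval, so its values lie between \<open>N L\<close> and
  \<open>N U\<close>. No value in between is skipped, because a continuous image of a connected set
  is connected (\<open>connected_norm_set\<close>).\<close>

lemma abs_le_upper_of_midpoint_nonneg:
  fixes L U A :: "real^'n^'n"
  assumes "0 \<le> midpoint_matrix L U" and "A \<in> {L..U}"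
  shows "\<bar>A\<bar> \<le> U"
  unfolding matrix_le_iff_entrywise
proof (intro allI)
  fix i j
  have "0 \<le> midpoint_matrix L U $ i $ j"
    using assms(1) by (simp add: matrix_le_iff_entrywise)
  then have "0 \<le> L $ i $ j + U $ i $ j"
    by (simp add: midpoint_matrix_def)
  moreover have "L $ i $ j \<le> A $ i $ j" "A $ i $ j \<le> U $ i $ j"
    using assms(2) by (auto simp: interval_matrix_eq)
  \<comment> \<open>The bound on the negative side is
    \<open>- A $ i $ j \<le> - L $ i $ j \<le> U $ i $ j\<close>, the last inequality being
    nonnegativity of the midpoint.\<close>
  ultimately show "\<bar>A\<bar> $ i $ j \<le> U $ i $ j"
    by (simp add: matrix_abs_entry)
qed

lemma monotone_norm_mono:
  fixes A B :: "real^'n^'n"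
  assumes "monotone_norm N" and "0 \<le> A" and "A \<le> B"
  shows "N A \<le> N B"
proof -
  have "\<bar>A\<bar> \<le> B"
    using assms(2,3) by (simp add: matrix_le_iff_entrywise matrix_abs_entry)
  then show ?thesis
    using assms(1) by (simp add: monotone_norm_def)
qed

text \<open>The order interval is a box, hence convex and connected, and a norm on a
  finite-dimensional space is continuous. This supplies the intermediate values in the second
  claim.\<close>

lemma connected_norm_set:
  fixes L U :: "real^'n^'n"
  assumes "matrix_norm N"
  shows "connected (norm_set N {L..U})"
proof -
  have "norm_set N {L..U} = N ` {L..U}"
    unfolding norm_set_def by auto
  moreover have "connected {L..U}"
    by (metis cbox_interval convex_box(1) convex_connected)
  moreover have "continuous_on {L..U} N"
    using matrix_norm_continuous[OF assms] continuous_on_subset by blast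
  ultimately show ?thesis
    by (simp add: connected_continuous_image)
qed

theorem theorem22:
  fixes N :: "real^'n^'n \<Rightarrow> real"
    and L U :: "real^'n^'n"
  assumes "matrix_norm N"
    and "monotone_norm N"
    and "L \<le> U"
  shows "(0 \<le> midpoint_matrix L U \<longrightarrow> upper_norm N {L..U} = N U) \<and>
    (nonneg_matrix_set {L..U} \<longrightarrow> norm_set N {L..U} = {N L..N U})"
proof (intro conjI impI)
  have ends: "N L \<in> norm_set N {L..U}" "N U \<in> norm_set N {L..U}"
    using assms(3) by (auto simp: norm_set_def)
  show "upper_norm N {L..U} = N U" if mid: "0 \<le> midpoint_matrix L U"
    unfolding upper_norm_def
  \<comment> \<open>\<open>GREATEST\<close> is pinned down by one attained upper bound, here
    \<open>N U\<close>.\<close>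
  proof (rule Greatest_equality)
    fix r assume "r \<in> norm_set N {L..U}"
    then obtain A where "A \<in> {L..U}" "r = N A"
      by (auto simp: norm_set_def)
    then show "r \<le> N U"
      using abs_le_upper_of_midpoint_nonneg[OF mid] assms(2)
      by (simp add: monotone_norm_def)
  qed (fact ends(2))
  show "norm_set N {L..U} = {N L..N U}" if nonneg: "nonneg_matrix_set {L..U}"
  proof
    show "norm_set N {L..U} \<subseteq> {N L..N U}"
    proof
      fix r assume "r \<in> norm_set N {L..U}"
      then obtain A where A: "A \<in> {L..U}" "r = N A"
        by (auto simp: norm_set_def)
      \<comment> \<open>\<open>L\<close> is itself a member of the interval, since
        \<open>L \<le> U\<close>.\<close>
      have "0 \<le> L" "0 \<le> A"
        using nonneg A(1) assms(3) by (auto simp: nonneg_matrix_set_def)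
      then show "r \<in> {N L..N U}"
        using A monotone_norm_mono[OF assms(2)] by simp
    qed
    show "{N L..N U} \<subseteq> norm_set N {L..U}"
      \<comment> \<open>A connected set of reals contains the whole segment between any two of its
        points, here the attained values \<open>N L\<close> and \<open>N U\<close>.\<close>
      using connected_contains_Icc[OF connected_norm_set[OF assms(1)] ends] .
  qed
qed

end
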